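(* In the online allocation model with full compatibility and homogeneous bonuses ($f_i=f$ for all products $i$, with $f:\mathbb Z_+\to\mathbb R_+$ nonnegative, nondecreasing, $f(0)=0$), there is no online algorithm $\pi$ and constant $c>1/2$ such that $\mathbb E[\mathrm{Rev}^\pi]\ge c\,\mathbb E[U(L)]$ holds for all problem instances.
   Context: Model. An instance consists of products $\mathcal I=\{1,\dots,m\}$, capacities $b_i\in\mathbb Z_+$, base rewards $r_i\ge 0$, bonus functions $f_i:\mathbb Z_+\to\mathbb R_+$ that are nonnegative and nondecreasing with $f_i(0)=0$, a horizon of $T$ periods and arrival probabilities $p_1,\dots,p_T\in[0,1]$. In period $t$ a customer arrives with probability $p_t$, independently across periods; $L$ is the total number of arrivals. Each arriving customer must be immediately and irrevocably assigned to a product with remaining capacity or rejected; every customer may be assigned to every product (full compatibility). The $k$-th sale of product $i$ yields reward $r_i+f_i(k)$, so $n$ sales yield $R_i(n)=n r_i+\sum_{k=1}^n f_i(k)$, $R_i(0)=0$. An online algorithm $\pi$ knows all parameters of the instance (including the $p_t$), but its decision in each period depends only on the arrivals observed so far, its past decisions and internal randomization independent of the arrivals. $\mathrm{Rev}^\pi$ is its random total reward. Offline benchmark: $U(\ell)=\max\{\sum_{i\in\mathcal I}R_i(x_i): \boldsymbol x\in\mathbb Z_+^m,\ x_i\le b_i\ \forall i,\ \sum_i x_i\le \ell\}$ for $\ell\in\mathbb Z_+$. *)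

theory Defs
  imports "HOL-Probability.Probability" "HOL-Probability.Product_PMF"
begin

text \<open>Products are \<open>1, \<dots>, num_products\<close> and periods are \<open>1, \<dots>, horizon\<close>; the values of the
  function fields outside these ranges are never used.\<close>

record alloc_instance =
  num_products :: nat
  capacity :: "nat \<Rightarrow> nat"
  base_reward :: "nat \<Rightarrow> real"
  bonus :: "nat \<Rightarrow> nat \<Rightarrow> real"
  horizon :: nat
  arrival_prob :: "nat \<Rightarrow> real"

definition products :: "alloc_instance \<Rightarrow> nat set" where
  "products I = {1..num_products I}"

definition valid_instance :: "alloc_instance \<Rightarrow> bool" where
  "valid_instance I \<longleftrightarrow>
     (\<forall>i\<in>products I. base_reward I i \<ge> 0 \<and> (\<forall>k. bonus I i k \<ge> 0) \<and>
        mono (bonus I i) \<and> bonus I i 0 = 0) \<and>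
     (\<forall>t\<in>{1..horizon I}. 0 \<le> arrival_prob I t \<and> arrival_prob I t \<le> 1)"

definition homogeneous_bonuses :: "alloc_instance \<Rightarrow> bool" where
  "homogeneous_bonuses I \<longleftrightarrow> (\<exists>f. \<forall>i\<in>products I. bonus I i = f)"

definition reward :: "alloc_instance \<Rightarrow> nat \<Rightarrow> nat \<Rightarrow> real" where
  "reward I i n = real n * base_reward I i + (\<Sum>k=1..n. bonus I i k)"

definition offline_opt :: "alloc_instance \<Rightarrow> nat \<Rightarrow> real" where
  "offline_opt I l =
     Max ((\<lambda>x. \<Sum>i\<in>products I. reward I i (x i)) `
       {x \<in> (\<Pi>\<^sub>E i\<in>products I. {..capacity I i}). (\<Sum>i\<in>products I. x i) \<le> l})"

definition arrivals :: "alloc_instance \<Rightarrow> (nat \<Rightarrow> bool) pmf" where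
  "arrivals I = Pi_pmf {1..horizon I} False (\<lambda>t. bernoulli_pmf (arrival_prob I t))"

definition num_arrivals :: "alloc_instance \<Rightarrow> (nat \<Rightarrow> bool) \<Rightarrow> nat" where
  "num_arrivals I a = card {t \<in> {1..horizon I}. a t}"

definition expected_offline :: "alloc_instance \<Rightarrow> real" where
  "expected_offline I = measure_pmf.expectation (arrivals I) (\<lambda>a. offline_opt I (num_arrivals I a))"

text \<open>A decision rule maps the arrival indicators of all periods up to and including the current one,
  and the decisions of all earlier periods, to a decision for the customer arriving now:
  \<open>Some i\<close> assigns product \<open>i\<close> and \<open>None\<close> rejects. A period without arrival is recorded
  as \<open>None\<close>.\<close>

type_synonym decision_rule = "bool list \<Rightarrow> nat option list \<Rightarrow> nat option"

fun decisions :: "decision_rule \<Rightarrow> (nat \<Rightarrow> bool) \<Rightarrow> nat \<Rightarrow> nat option list" where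
  "decisions d a 0 = []"
| "decisions d a (Suc t) = decisions d a t @
     [if a (Suc t) then d (map a [1..<Suc (Suc t)]) (decisions d a t) else None]"

definition sales :: "decision_rule \<Rightarrow> (nat \<Rightarrow> bool) \<Rightarrow> nat \<Rightarrow> nat \<Rightarrow> nat" where
  "sales d a t i = count_list (decisions d a t) (Some i)"

definition feasible_rule :: "alloc_instance \<Rightarrow> decision_rule \<Rightarrow> bool" where
  "feasible_rule I d \<longleftrightarrow>
     (\<forall>a. \<forall>t<horizon I. \<forall>i. decisions d a (Suc t) ! t = Some i \<longrightarrow>
        i \<in> products I \<and> sales d a t i < capacity I i)"

definition total_reward :: "alloc_instance \<Rightarrow> decision_rule \<Rightarrow> (nat \<Rightarrow> bool) \<Rightarrow> real" where
  "total_reward I d a = (\<Sum>i\<in>products I. reward I i (sales d a (horizon I) i))"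

text \<open>The internal randomization is a random seed, drawn once from an arbitrary probability space;
  given the seed, the algorithm follows a deterministic decision rule. Independence of the seed
  from the arrivals is expressed by the product measure in \<open>expected_reward\<close>.\<close>

record 's online_alg =
  seed_space :: "'s measure"
  rule_of :: "'s \<Rightarrow> decision_rule"

definition online_algorithm_for :: "alloc_instance \<Rightarrow> 's online_alg \<Rightarrow> bool" where
  "online_algorithm_for I A \<longleftrightarrow>
     prob_space (seed_space A) \<and>
     (\<forall>as ds. (\<lambda>s. rule_of A s as ds) \<in> measurable (seed_space A) (count_space UNIV)) \<and>
     (\<forall>s\<in>space (seed_space A). feasible_rule I (rule_of A s))"

definition expected_reward :: "alloc_instance \<Rightarrow> 's online_alg \<Rightarrow> real" where
  "expected_reward I A =
     (\<integral>(s, a). total_reward I (rule_of A s) a \<partial>(seed_space A \<Otimes>\<^sub>M measure_pmf (arrivals I)))"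

end

theory Submission imports Defs begin

text \<open>The first customer surely arrives, the second one only with probability \<open>\<epsilon>\<close>. Product \<open>1\<close> has a
  single unit, worth \<open>1\<close>; product \<open>2\<close> earns \<open>1 / \<epsilon>\<close> if it is sold twice and nothing otherwise.
  An online algorithm has to commit the first customer either to the sure reward \<open>1\<close> or to the
  gamble of mean \<open>1\<close>, so it earns at most \<open>1\<close>, while the offline optimum earns
  \<open>(1 - \<epsilon>) \<cdot> 1 + \<epsilon> \<cdot> (1 / \<epsilon>) = 2 - \<epsilon>\<close> in expectation.\<close>

definition gamble :: "real \<Rightarrow> alloc_instance" where
  "gamble e =
     \<lparr>num_products = 2, capacity = (\<lambda>i. i), base_reward = (\<lambda>i. if i = 1 then 1 else 0),
      bonus = (\<lambda>_ k. if k \<ge> 2 then 1 / e else 0), horizon = 2,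
      arrival_prob = (\<lambda>t. if t = 1 then 1 else e)\<rparr>"

lemma gamble_simps [simp]:
  "num_products (gamble e) = 2" "capacity (gamble e) = (\<lambda>i. i)"
  "base_reward (gamble e) i = (if i = 1 then 1 else 0)"
  "bonus (gamble e) i = (\<lambda>k. if k \<ge> 2 then 1 / e else 0)"
  "horizon (gamble e) = 2" "arrival_prob (gamble e) = (\<lambda>t. if t = 1 then 1 else e)"
  by (simp_all add: gamble_def)

lemma atLeastAtMost_1_2: "{Suc 0..2} = {1, 2}"
  by auto

lemma products_gamble [simp]: "products (gamble e) = {1, 2}"
  by (simp add: products_def atLeastAtMost_1_2)

lemma valid_gamble: "0 < e \<Longrightarrow> e \<le> 1 \<Longrightarrow> valid_instance (gamble e)"
  by (auto simp: valid_instance_def mono_def)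

text \<open>Both products can share the bonus that starts at the second sale: product 1 has a single
  unit and never reaches it.\<close>

lemma homogeneous_gamble: "homogeneous_bonuses (gamble e)"
  by (simp add: homogeneous_bonuses_def)

lemma reward_gamble:
  "reward (gamble e) i 0 = 0"
  "reward (gamble e) i (Suc 0) = (if i = 1 then 1 else 0)"
  "reward (gamble e) 2 2 = 1 / e"
  by (simp_all add: reward_def atLeastAtMost_1_2)

text \<open>These are the only patterns that can occur; \<open>b\<close> tells whether the second
  customer comes.\<close>

definition gamble_arrivals :: "bool \<Rightarrow> nat \<Rightarrow> bool" where
  "gamble_arrivals b = (\<lambda>t. t = 1 \<or> t = 2 \<and> b)"

lemma arrivals_gamble: "arrivals (gamble e) = map_pmf gamble_arrivals (bernoulli_pmf e)"
proof -
  have one: "bernoulli_pmf 1 = return_pmf True"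
  proof (rule pmf_eqI)
    show "pmf (bernoulli_pmf 1) b = pmf (return_pmf True) b" for b
      by (cases b) simp_all
  qed
  \<comment> \<open>The two coordinates are split off one by one; the first coin is constant, so a
    single coin remains.\<close>
  have "arrivals (gamble e) =
      map_pmf (\<lambda>(x, f). f(1 := x)) (pair_pmf (return_pmf True)
        (map_pmf (\<lambda>(x, f). f(2 := x)) (pair_pmf (bernoulli_pmf e) (return_pmf (\<lambda>_. False)))))"
    by (simp add: arrivals_def atLeastAtMost_1_2 Pi_pmf_insert one)
  also have "\<dots> = map_pmf gamble_arrivals (bernoulli_pmf e)"
    by (auto simp: pair_return_pmf1 pair_return_pmf2 pmf.map_comp gamble_arrivals_def o_def fun_eq_iff
        intro!: map_pmf_cong)
  finally show ?thesis .
qed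

lemma expectation_arrivals_gamble:
  fixes F :: "(nat \<Rightarrow> bool) \<Rightarrow> real"
  assumes "0 \<le> e" "e \<le> 1"
  shows "measure_pmf.expectation (arrivals (gamble e)) F =
    e * F (gamble_arrivals True) + (1 - e) * F (gamble_arrivals False)"
  using assms by (simp add: arrivals_gamble)

lemma offline_opt_ge:
  assumes "x \<in> (\<Pi>\<^sub>E i\<in>products I. {..capacity I i})" "(\<Sum>i\<in>products I. x i) \<le> l"
  shows "(\<Sum>i\<in>products I. reward I i (x i)) \<le> offline_opt I l"
proof -
  have "finite (\<Pi>\<^sub>E i\<in>products I. {..capacity I i})"
    by (rule finite_PiE) (simp_all add: products_def)
  then show ?thesis
    unfolding offline_opt_def using assms by (intro Max_ge) auto
qed

lemma expected_offline_gamble: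
  assumes "0 < e" "e \<le> 1"
  shows "2 - e \<le> expected_offline (gamble e)"
proof -
  have "{t \<in> {1..2::nat}. gamble_arrivals True t} = {1, 2}"
    "{t \<in> {1..2::nat}. gamble_arrivals False t} = {1}"
    by (auto simp: gamble_arrivals_def)
  then have n: "num_arrivals (gamble e) (gamble_arrivals True) = 2"
    "num_arrivals (gamble e) (gamble_arrivals False) = 1"
    by (simp_all add: num_arrivals_def)
  \<comment> \<open>Witness: sell product 2 twice. The value \<open>undefined\<close> off the
    products is what membership in \<open>PiE\<close> demands.\<close>
  have "1 / e \<le> offline_opt (gamble e) 2"
    using offline_opt_ge[of "\<lambda>i. if i = 1 then 0 else if i = 2 then 2 else undefined" "gamble e" 2]
    by (auto simp: PiE_iff extensional_def reward_gamble)
  then have "1 \<le> e * offline_opt (gamble e) 2"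
    using assms by (simp add: field_simps)
  \<comment> \<open>Witness: give the only customer product 1.\<close>
  moreover have "1 \<le> offline_opt (gamble e) 1"
    using offline_opt_ge[of "\<lambda>i. if i = 1 then 1 else if i = 2 then 0 else undefined" "gamble e" 1]
    by (auto simp: PiE_iff extensional_def reward_gamble)
  then have "1 - e \<le> (1 - e) * offline_opt (gamble e) 1"
    using assms mult_left_mono[of 1 "offline_opt (gamble e) 1" "1 - e"] by simp
  ultimately show ?thesis
    using assms by (simp add: expected_offline_def expectation_arrivals_gamble n)
qed

text \<open>If the first customer gets product 1, the second adds nothing. Otherwise any reward
  requires the second arrival and is at most \<open>1 / e\<close>, so the mean is at most 1.\<close>

lemma expectation_total_reward_gamble:
  assumes "feasible_rule (gamble e) d" "0 < e" "e \<le> 1"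
  shows "measure_pmf.expectation (arrivals (gamble e)) (total_reward (gamble e) d) \<le> 1"
proof -
  \<comment> \<open>As the first customer surely arrives, \<open>x\<close> and \<open>y\<close> are
    the only values of \<open>d\<close> that matter.\<close>
  define x where "x = d [True] []"
  define y where "y = d [True, True] [x]"
  have dec: "decisions d (gamble_arrivals b) 1 = [x]"
    "decisions d (gamble_arrivals b) 2 = [x, if b then y else None]" for b
    by (simp_all add: numeral_2_eq_2 gamble_arrivals_def x_def y_def)
  have feas: "i \<in> {1, 2} \<and> sales d a t i < i"
    if "decisions d a (Suc t) ! t = Some i" "t < 2" for a t i
    using assms(1) that by (simp add: feasible_rule_def)
  have x: "x \<in> {None, Some 1, Some 2}"
    using feas[of "gamble_arrivals True" 0] dec(1)[of True] by (cases x) auto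
  have y: "y \<in> {None, Some 1, Some 2}" "y = Some 1 \<Longrightarrow> x \<noteq> Some 1"
    using feas[of "gamble_arrivals True" 1] dec(1)[of True] dec(2)[of True]
    by (cases y; auto simp: sales_def numeral_2_eq_2)+
  have total: "total_reward (gamble e) d (gamble_arrivals b) =
      (\<Sum>i\<in>{1, 2}. reward (gamble e) i (count_list [x, if b then y else None] (Some i)))" for b
    by (simp add: total_reward_def sales_def dec)
  show ?thesis
    using x y assms(2,3)
    by (auto simp: expectation_arrivals_gamble total reward_gamble
        numeral_2_eq_2[symmetric])
qed

text \<open>The assumption \<open>0 \<le> B\<close> covers a non-integrable total reward, whose integral is \<open>0\<close>.\<close>

lemma expected_reward_le:
  assumes A: "online_algorithm_for I A" and "0 \<le> B"
    and B: "\<And>d. feasible_rule I d \<Longrightarrow>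
      measure_pmf.expectation (arrivals I) (total_reward I d) \<le> B"
  shows "expected_reward I A \<le> B"
proof -
  interpret S: prob_space "seed_space A"
    using A by (simp add: online_algorithm_for_def)
  interpret P: pair_prob_space "seed_space A" "measure_pmf (arrivals I)" ..
  let ?F = "\<lambda>(s, a). total_reward I (rule_of A s) a"
  show ?thesis
  proof (cases "integrable (seed_space A \<Otimes>\<^sub>M measure_pmf (arrivals I)) ?F")
    case True
    \<comment> \<open>Fubini with the seed outermost: each fixed seed gives a deterministic feasible
      rule, to which the bound \<open>B\<close> applies.\<close>
    have "expected_reward I A =
        (\<integral>s. measure_pmf.expectation (arrivals I) (total_reward I (rule_of A s)) \<partial>seed_space A)"
      using P.integral_fst'[OF True] by (simp add: expected_reward_def)
    also have "\<dots> \<le> B"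
      using P.integrable_fst'[OF True] A B
      by (intro S.integral_le_const) (auto simp: online_algorithm_for_def)
    finally show ?thesis .
  next
    case False
    then show ?thesis
      using \<open>0 \<le> B\<close> by (simp add: expected_reward_def not_integrable_integral_eq)
  qed
qed

theorem theorem2:
  "\<not> (\<exists>(\<pi> :: alloc_instance \<Rightarrow> 's online_alg) (c :: real). c > 1 / 2 \<and>
        (\<forall>I. valid_instance I \<and> homogeneous_bonuses I \<longrightarrow>
           online_algorithm_for I (\<pi> I) \<and>
           expected_reward I (\<pi> I) \<ge> c * expected_offline I))"
proof
  assume "\<exists>(\<pi> :: alloc_instance \<Rightarrow> 's online_alg) (c :: real). c > 1 / 2 \<and>
        (\<forall>I. valid_instance I \<and> homogeneous_bonuses I \<longrightarrow>
           online_algorithm_for I (\<pi> I) \<and>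
           expected_reward I (\<pi> I) \<ge> c * expected_offline I)"
  then obtain \<pi> :: "alloc_instance \<Rightarrow> 's online_alg" and c :: real where c: "c > 1 / 2"
    and \<pi>: "\<And>I. valid_instance I \<Longrightarrow> homogeneous_bonuses I \<Longrightarrow>
      online_algorithm_for I (\<pi> I) \<and> expected_reward I (\<pi> I) \<ge> c * expected_offline I"
    by blast
  \<comment> \<open>Chosen so that \<open>c * (2 - e)\<close> equals \<open>c + 1 / 2\<close>, which
    exceeds 1; \<open>e\<close> is positive exactly because \<open>c > 1 / 2\<close>.\<close>
  define e where "e = 1 - 1 / (2 * c)"
  have e: "0 < e" "e \<le> 1"
    using c by (simp_all add: e_def field_simps)
  note alg = \<pi>[OF valid_gamble[OF e] homogeneous_gamble]
  have "c + 1 / 2 = c * (2 - e)"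
    using c by (simp add: e_def field_simps)
  also have "\<dots> \<le> c * expected_offline (gamble e)"
    using expected_offline_gamble[OF e] c by (intro mult_left_mono) auto
  also have "\<dots> \<le> 1"
    using alg expected_reward_le[of "gamble e" "\<pi> (gamble e)" 1]
      expectation_total_reward_gamble e by fastforce
  finally show False
    using c by simp
qed

end
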